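(* Under homogeneous Dirichlet or periodic boundary conditions, and in the absence of external force ($\bm f=\bm 0$), the following BDF1 scheme preserves a discrete energy dissipation law. Scheme: given $\bm u^0$, for $0\le n\le N_t-1$ the pair $(\bm u^{n+1},p^{n+1})$ satisfies $$\frac{\bm u^{n+1}-\bm u^n}{\tau}-\nu\Delta\bm u^{n+1}+\bm B(\bm u^n,\bm u^{n+1})+\nabla p^{n+1}=\bm f^{n+1},\qquad \nabla\cdot\bm u^{n+1}=0 .$$ Energy law: for $0\le n\le N_t-1$, $$\frac{E^{n+1}-E^n}{\tau}=-\nu\|\nabla\bm u^{n+1}\|^2-\frac1{2\tau}\|\bm u^{n+1}-\bm u^n\|^2,\qquad E^n=\frac12\|\bm u^n\|^2 .$$
   Context: $\Omega\subset\mathbb R^d$ ($d=2,3$) is a rectangular domain, $\nu>0$, $T>0$, $N_t$ is a positive integer, $\tau=T/N_t$, $t_n=n\tau$; $\bm f^{n+1}$ is the external force at time $t_{n+1}$. $(\cdot,\cdot)$ and $\|\cdot\|$ denote the $L^2(\Omega)$ inner product and norm (for vector and matrix fields, summed over components). The $\bm u^n$ are $\mathbb R^d$-valued velocity fields on $\Omega$ and $p^{n+1}$ are scalar pressures. The computed velocities $\bm u^{n+1}$ satisfy either $\bm u^{n+1}=\bm 0$ on $\partial\Omega$ (homogeneous Dirichlet), or periodicity (then pressures are periodic too). All fields are smooth enough for the expressions to make sense. $(\bm u\cdot\nabla\bm u)_i=\sum_j u_j\partial_j u_i$. $\bm F$ is a user-specified map taking a vector field $\bm u$ on $\Omega$ to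 a vector field $\bm F(\bm u)$ on $\Omega$ and satisfying the non-degeneracy condition $(\bm F(\bm u),\bm u)\neq 0$ whenever $\|\bm u\|\neq 0$. Define $$\bm G(\bm u)=\frac{\bm u\cdot\nabla\bm u}{(\bm F(\bm u),\bm u)}\ \text{ if }\|\bm u\|\ne0,\qquad \bm G(\bm u)=\bm 0\ \text{ otherwise},$$ $$\bm B(\bm u,\bm v)=\big(\bm F(\bm u),\bm v\big)\bm G(\bm u)-\big(\bm G(\bm u),\bm v\big)\bm F(\bm u).$$ *)

theory Defs
  imports "HOL-Analysis.Analysis"
begin

type_synonym 'd vfield = "real ^ 'd \<Rightarrow> real ^ 'd"
type_synonym 'd sfield = "real ^ 'd \<Rightarrow> real"

section \<open>Lebesgue inner product and norm\<close>

text \<open>For vector- and matrix-valued fields the inner product of the codomain is the sum over all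
  components (for \<^typ>\<open>real ^ 'd ^ 'd\<close> this is the Frobenius product).\<close>

definition l2_inner :: "(real ^ 'd) set \<Rightarrow> (real ^ 'd \<Rightarrow> 'b::euclidean_space) \<Rightarrow> (real ^ 'd \<Rightarrow> 'b) \<Rightarrow> real" where
  "l2_inner \<Omega> f g = integral\<^sup>L (lebesgue_on \<Omega>) (\<lambda>x. f x \<bullet> g x)"

definition l2_norm :: "(real ^ 'd) set \<Rightarrow> (real ^ 'd \<Rightarrow> 'b::euclidean_space) \<Rightarrow> real" where
  "l2_norm \<Omega> f = sqrt (l2_inner \<Omega> f f)"

definition square_integrable :: "(real ^ 'd) set \<Rightarrow> (real ^ 'd \<Rightarrow> 'b::euclidean_space) \<Rightarrow> bool" where
  "square_integrable \<Omega> f \<longleftrightarrow>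
     f \<in> borel_measurable (lebesgue_on \<Omega>) \<and> integrable (lebesgue_on \<Omega>) (\<lambda>x. (norm (f x))\<^sup>2)"

section \<open>Differential operators and smoothness up to the boundary\<close>

text \<open>The derivative is taken within the closure of the domain. At points of the open set \<open>\<Omega>\<close> it is
  the ordinary partial derivative; at boundary points it is the one-sided one, so that no values
  outside the closure are ever used.\<close>

definition partial_deriv ::
  "(real ^ 'd) set \<Rightarrow> 'd \<Rightarrow> (real ^ 'd \<Rightarrow> 'b::euclidean_space) \<Rightarrow> real ^ 'd \<Rightarrow> 'b" where
  "partial_deriv \<Omega> i f x = frechet_derivative f (at x within closure \<Omega>) (axis i 1)"

definition C1_closure :: "(real ^ 'd) set \<Rightarrow> (real ^ 'd \<Rightarrow> 'b::euclidean_space) \<Rightarrow> bool" where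
  "C1_closure \<Omega> f \<longleftrightarrow>
     f differentiable_on closure \<Omega> \<and> (\<forall>i. continuous_on (closure \<Omega>) (partial_deriv \<Omega> i f))"

definition C2_closure :: "(real ^ 'd) set \<Rightarrow> (real ^ 'd \<Rightarrow> 'b::euclidean_space) \<Rightarrow> bool" where
  "C2_closure \<Omega> f \<longleftrightarrow> C1_closure \<Omega> f \<and> (\<forall>i. C1_closure \<Omega> (partial_deriv \<Omega> i f))"

definition gradient :: "(real ^ 'd) set \<Rightarrow> 'd sfield \<Rightarrow> 'd vfield" where
  "gradient \<Omega> p x = (\<chi> i. partial_deriv \<Omega> i p x)"

definition vgradient :: "(real ^ 'd) set \<Rightarrow> 'd vfield \<Rightarrow> real ^ 'd \<Rightarrow> real ^ 'd ^ 'd" where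
  "vgradient \<Omega> u x = (\<chi> i j. partial_deriv \<Omega> j u x $ i)"

definition divergence :: "(real ^ 'd) set \<Rightarrow> 'd vfield \<Rightarrow> 'd sfield" where
  "divergence \<Omega> u x = (\<Sum>i\<in>UNIV. partial_deriv \<Omega> i u x $ i)"

definition vlaplacian :: "(real ^ 'd) set \<Rightarrow> 'd vfield \<Rightarrow> 'd vfield" where
  "vlaplacian \<Omega> u x = (\<Sum>i\<in>UNIV. partial_deriv \<Omega> i (partial_deriv \<Omega> i u) x)"

definition convection :: "(real ^ 'd) set \<Rightarrow> 'd vfield \<Rightarrow> 'd vfield" where
  "convection \<Omega> u x = (\<chi> i. \<Sum>j\<in>UNIV. u x $ j * partial_deriv \<Omega> j u x $ i)"

section \<open>Boundary conditions\<close>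

definition dirichlet_bc :: "(real ^ 'd) set \<Rightarrow> 'd vfield \<Rightarrow> bool" where
  "dirichlet_bc \<Omega> u \<longleftrightarrow> (\<forall>x\<in>frontier \<Omega>. u x = 0)"

definition faces_match :: "real ^ 'd \<Rightarrow> real ^ 'd \<Rightarrow> (real ^ 'd \<Rightarrow> 'b) \<Rightarrow> bool" where
  "faces_match a b g \<longleftrightarrow>
     (\<forall>i. \<forall>x\<in>cbox a b. x $ i = a $ i \<longrightarrow> g (x + axis i (b $ i - a $ i)) = g x)"

text \<open>Periodicity on the box with corners \<open>a\<close> and \<open>b\<close>: the periodic extension of the velocity is
  \<open>C\<^sup>1\<close> and that of the pressure is continuous. Matching of second derivatives of the velocity or
  of first derivatives of the pressure is not required.\<close>

definition periodic_velocity :: "real ^ 'd \<Rightarrow> real ^ 'd \<Rightarrow> 'd vfield \<Rightarrow> bool" where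
  "periodic_velocity a b u \<longleftrightarrow>
     faces_match a b u \<and> (\<forall>j. faces_match a b (partial_deriv (box a b) j u))"

definition periodic_pressure :: "real ^ 'd \<Rightarrow> real ^ 'd \<Rightarrow> 'd sfield \<Rightarrow> bool" where
  "periodic_pressure a b p \<longleftrightarrow> faces_match a b p"

section \<open>The nonlinear term and the scheme\<close>

text \<open>The condition is asked for those smooth fields \<open>w\<close> for which the pairing of \<open>F w\<close> with \<open>w\<close>
  makes sense.\<close>

definition nondegenerate :: "(real ^ 'd) set \<Rightarrow> ('d vfield \<Rightarrow> 'd vfield) \<Rightarrow> bool" where
  "nondegenerate \<Omega> F \<longleftrightarrow>
     (\<forall>w. C2_closure \<Omega> w \<and> square_integrable \<Omega> (F w) \<and> l2_norm \<Omega> w \<noteq> 0 \<longrightarrow> l2_inner \<Omega> (F w) w \<noteq> 0)"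

definition G_op :: "(real ^ 'd) set \<Rightarrow> ('d vfield \<Rightarrow> 'd vfield) \<Rightarrow> 'd vfield \<Rightarrow> 'd vfield" where
  "G_op \<Omega> F u = (if l2_norm \<Omega> u \<noteq> 0
                 then (\<lambda>x. convection \<Omega> u x /\<^sub>R l2_inner \<Omega> (F u) u)
                 else (\<lambda>x. 0))"

definition B_op ::
  "(real ^ 'd) set \<Rightarrow> ('d vfield \<Rightarrow> 'd vfield) \<Rightarrow> 'd vfield \<Rightarrow> 'd vfield \<Rightarrow> 'd vfield" where
  "B_op \<Omega> F u v x =
     l2_inner \<Omega> (F u) v *\<^sub>R G_op \<Omega> F u x - l2_inner \<Omega> (G_op \<Omega> F u) v *\<^sub>R F u x"

definition bdf1_step ::
  "(real ^ 'd) set \<Rightarrow> real \<Rightarrow> real \<Rightarrow> ('d vfield \<Rightarrow> 'd vfield) \<Rightarrow> 'd vfield \<Rightarrow>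
   'd vfield \<Rightarrow> 'd vfield \<Rightarrow> 'd sfield \<Rightarrow> bool" where
  "bdf1_step \<Omega> \<nu> \<tau> F f u_old u_new p_new \<longleftrightarrow>
     (\<forall>x\<in>\<Omega>. (u_new x - u_old x) /\<^sub>R \<tau> - \<nu> *\<^sub>R vlaplacian \<Omega> u_new x
              + B_op \<Omega> F u_old u_new x + gradient \<Omega> p_new x = f x) \<and>
     (\<forall>x\<in>\<Omega>. divergence \<Omega> u_new x = 0)"

definition energy :: "(real ^ 'd) set \<Rightarrow> 'd vfield \<Rightarrow> real" where
  "energy \<Omega> u = 1 / 2 * (l2_norm \<Omega> u)\<^sup>2"

end

theory Submission
  imports Defs
begin

text \<open>
  Take the \<open>L\<^sup>2\<close> inner product of the momentum equation with the new velocity \<open>v = u\<^sup>n\<^sup>+\<^sup>1\<close>, the old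
  one being \<open>w = u\<^sup>n\<close>. Each term then has a fixed fate.

  The time difference gives the energy increment plus \<open>\<parallel>v - w\<parallel>\<^sup>2 / 2\<close> by polarization
  (\<open>l2_inner_increment\<close>). The nonlinear term vanishes: \<open>B w v = (F w, v) G w - (G w, v) F w\<close> is
  antisymmetric, so pairing it with \<open>v\<close> gives \<open>(F w, v) (G w, v) - (G w, v) (F w, v)\<close>
  (\<open>B_op_energy_neutral\<close>); since \<open>F w\<close> is merely square integrable, the pairings have to be shown to
  converge before the integral may be split. The pressure term vanishes because \<open>- \<nabla>\<close> is the adjoint
  of the divergence (\<open>l2_inner_gradient_divergence\<close>), and the viscous term gives the dissipation
  (\<open>l2_inner_vlaplacian\<close>).

  The last two facts are integrations by parts. Both reduce to one statement: a directional derivative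
  along an edge of a box has integral zero if the function takes equal values at opposite points of the
  two faces orthogonal to that edge (\<open>integral_box_directional_derivative_eq_0\<close>). This is Fubini's
  theorem followed by the fundamental theorem of calculus on each line parallel to the edge. The
  functions it is applied to are \<open>p v\<^sub>i\<close> and \<open>\<partial>\<^sub>i v \<bullet> v\<close>. Requiring equal values on opposite faces
  treats both boundary conditions at once: in the periodic case each factor matches, and in the
  Dirichlet case the product is zero on the whole boundary.
\<close>

section \<open>Integrals of directional derivatives over a box\<close>

lemma integrable_on_box:
  fixes h :: "'a::euclidean_space \<Rightarrow> 'b::euclidean_space"
  assumes "continuous_on (cbox a b) h"
  shows "integrable (lebesgue_on (box a b)) h"
proof -
  have "set_integrable lebesgue (cbox a b) h"
    by (rule absolutely_integrable_continuous[OF assms])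
  then have "set_integrable lebesgue (box a b) h"
    by (rule set_integrable_subset) (auto simp: box_subset_cbox)
  then show ?thesis
    by (simp add: set_integrable_def integrable_restrict_space)
qed

text \<open>Passing to the closed box and to Borel measure makes Fubini's theorem for product measures
  applicable; the boundary of the box is a null set.\<close>

lemma integral_box_eq_lborel:
  fixes h :: "'a::euclidean_space \<Rightarrow> 'b::euclidean_space"
  assumes "continuous_on (cbox a b) h"
  shows "integral\<^sup>L (lebesgue_on (box a b)) h = (\<integral>x. indicator (cbox a b) x *\<^sub>R h x \<partial>lborel)"
proof -
  have "integral\<^sup>L (lebesgue_on (box a b)) h = integral (box a b) h"
    by (rule lebesgue_integral_eq_integral[OF integrable_on_box[OF assms]]) auto
  also have "\<dots> = integral (cbox a b) h"
    by (rule integral_open_interval)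
  also have "\<dots> = integral\<^sup>L (lebesgue_on (cbox a b)) h"
    by (rule lebesgue_integral_eq_integral[symmetric, OF continuous_imp_integrable[OF assms]]) auto
  also have "\<dots> = (\<integral>x. indicator (cbox a b) x *\<^sub>R h x \<partial>lebesgue)"
    by (rule integral_restrict_space) auto
  also have "\<dots> = (\<integral>x. indicator (cbox a b) x *\<^sub>R h x \<partial>lborel)"
    using borel_integrable_compact[OF compact_cbox assms]
    by (intro integral_completion) auto
  finally show ?thesis .
qed

text \<open>Integrate first along the lines in direction \<open>k\<close>. On a line that meets the box the inner integral
  is the difference of the values of \<open>g\<close> at the two ends, which \<open>faces\<close> makes zero; on every other
  line the integrand is zero.\<close>

lemma integral_box_directional_derivative_eq_0:
  fixes g :: "'a::euclidean_space \<Rightarrow> 'b::euclidean_space"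
  assumes k: "k \<in> Basis" and ab: "a \<bullet> k \<le> b \<bullet> k"
    and der: "\<And>x. x \<in> cbox a b \<Longrightarrow> (g has_derivative D x) (at x within cbox a b)"
    and cont: "continuous_on (cbox a b) (\<lambda>x. D x k)"
    and faces: "\<And>x. x \<in> cbox a b \<Longrightarrow> x \<bullet> k = a \<bullet> k \<Longrightarrow> g (x + (b \<bullet> k - a \<bullet> k) *\<^sub>R k) = g x"
  shows "integral\<^sup>L (lebesgue_on (box a b)) (\<lambda>x. D x k) = 0"
proof -
  define h where "h x = indicator (cbox a b) x *\<^sub>R D x k" for x
  define P where "P f = (\<Sum>j\<in>Basis. f j *\<^sub>R j)" for f :: "'a \<Rightarrow> real"
  interpret product_sigma_finite "\<lambda>_::'a. lborel :: real measure" ..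
  have P_inner: "P f \<bullet> j = f j" if "j \<in> Basis" for f j
    using that by (simp add: P_def)
  have P_meas: "P \<in> measurable (\<Pi>\<^sub>M j\<in>Basis. lborel) borel"
    unfolding P_def by measurable
  have lborel_P: "lborel = distr (\<Pi>\<^sub>M j\<in>Basis. lborel) borel P"
    using lborel_eq[where 'a='a] by (simp add: P_def[abs_def])
  have h_int: "integrable lborel h"
    unfolding h_def by (rule borel_integrable_compact[OF compact_cbox cont])
  have hP_int: "integrable (\<Pi>\<^sub>M j\<in>Basis. lborel) (\<lambda>f. h (P f))"
    using h_int integrable_distr[OF P_meas, of h] lborel_P by simp
  have line: "(\<integral>y. h (P (f(k := y))) \<partial>lborel) = 0" for f
  proof -
    \<comment> \<open>\<open>z\<close> is the point where the line through \<open>P f\<close> in direction \<open>k\<close> meets the hyperplane of the lower face.\<close>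
    define z where "z = P (f(k := a \<bullet> k))"
    have z_k: "z \<bullet> k = a \<bullet> k" using k by (simp add: z_def P_inner)
    have P_z: "P (f(k := y)) = z + (y - a \<bullet> k) *\<^sub>R k" for y
      by (rule euclidean_eqI) (use k in \<open>auto simp: z_def P_inner inner_add_left inner_Basis\<close>)
    have mem: "z + (y - a \<bullet> k) *\<^sub>R k \<in> cbox a b \<longleftrightarrow> z \<in> cbox a b \<and> y \<in> {a \<bullet> k..b \<bullet> k}" for y
    proof -
      have "(z + (y - a \<bullet> k) *\<^sub>R k) \<bullet> j = (if j = k then y else z \<bullet> j)" if "j \<in> Basis" for j
        using that k z_k by (auto simp: inner_add_left inner_Basis)
      then show ?thesis
        using k ab z_k by (auto simp: mem_box)
    qed
    show ?thesis
    proof (cases "z \<in> cbox a b")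
      case False
      then show ?thesis by (simp add: P_z h_def mem)
    next
      case True
      define l where "l y = z + (y - a \<bullet> k) *\<^sub>R k" for y
      have l_img: "l ` {a \<bullet> k..b \<bullet> k} \<subseteq> cbox a b"
        unfolding l_def using True by (intro image_subsetI) (simp only: mem)
      have l_der: "(l has_derivative (\<lambda>s. s *\<^sub>R k)) (at y within {a \<bullet> k..b \<bullet> k})" for y
        unfolding l_def by (auto intro!: derivative_eq_intros)
      have "((\<lambda>y. g (l y)) has_vector_derivative D (l y) k) (at y within {a \<bullet> k..b \<bullet> k})"
        if "a \<bullet> k \<le> y" "y \<le> b \<bullet> k" for y
      proof -
        have ly: "l y \<in> cbox a b" using l_img that by auto
        have "((\<lambda>y. g (l y)) has_derivative (\<lambda>s. D (l y) (s *\<^sub>R k))) (at y within {a \<bullet> k..b \<bullet> k})"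
          by (rule has_derivative_in_compose2[OF _ l_img _ l_der]) (use der that in auto)
        then show ?thesis
          using linear_scale[OF has_derivative_linear[OF der[OF ly]]]
          by (simp add: has_vector_derivative_def)
      qed
      moreover have "continuous_on {a \<bullet> k..b \<bullet> k} (\<lambda>y. D (l y) k)"
        by (rule continuous_on_compose2[OF cont _ l_img]) (unfold l_def, intro continuous_intros)
      ultimately have "(\<integral>y. indicator {a \<bullet> k..b \<bullet> k} y *\<^sub>R D (l y) k \<partial>lborel)
          = g (l (b \<bullet> k)) - g (l (a \<bullet> k))"
        using ab by (intro integral_FTC_atLeastAtMost) auto
      also have "\<dots> = 0"
        using faces[OF True z_k] by (simp add: l_def)
      finally show ?thesis
        using True by (simp add: P_z h_def l_def mem indicator_def)
    qed
  qed
  have "integral\<^sup>L (lebesgue_on (box a b)) (\<lambda>x. D x k) = integral\<^sup>L lborel h"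
    using integral_box_eq_lborel[OF cont] by (simp add: h_def[abs_def])
  also have "\<dots> = (\<integral>f. h (P f) \<partial>(\<Pi>\<^sub>M j\<in>Basis. lborel))"
    by (subst lborel_P, rule integral_distr[OF P_meas]) (use h_int in auto)
  also have "\<dots> = (\<integral>f. (\<integral>y. h (P (f(k := y))) \<partial>lborel) \<partial>(\<Pi>\<^sub>M j\<in>Basis - {k}. lborel))"
    using product_integral_insert[of "Basis - {k}" k "\<lambda>f. h (P f)"] hP_int k
    by (simp add: insert_absorb)
  finally show ?thesis by (simp add: line)
qed


section \<open>Square integrable fields and the energy increment\<close>

lemma l2_norm_power2: "(l2_norm \<Omega> f)\<^sup>2 = l2_inner \<Omega> f f"
  by (simp add: l2_norm_def l2_inner_def)

lemma integrable_inner_square_integrable: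
  assumes f: "square_integrable (box a b) f" and g: "continuous_on (cbox a b) g"
  shows "integrable (lebesgue_on (box a b)) (\<lambda>x. f x \<bullet> g x)"
proof (rule Bochner_Integration.integrable_bound)
  have g_meas: "g \<in> borel_measurable (lebesgue_on (box a b))"
    using integrable_on_box[OF g] by (rule borel_measurable_integrable)
  show "integrable (lebesgue_on (box a b)) (\<lambda>x. (norm (f x))\<^sup>2 + (norm (g x))\<^sup>2)"
  proof (rule Bochner_Integration.integrable_add)
    show "integrable (lebesgue_on (box a b)) (\<lambda>x. (norm (f x))\<^sup>2)"
      using f by (simp add: square_integrable_def)
    show "integrable (lebesgue_on (box a b)) (\<lambda>x. (norm (g x))\<^sup>2)"
      by (intro integrable_on_box continuous_intros g)
  qed
  show "(\<lambda>x. f x \<bullet> g x) \<in> borel_measurable (lebesgue_on (box a b))"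
    using f g_meas by (auto simp: square_integrable_def)
  have "\<bar>f x \<bullet> g x\<bar> \<le> (norm (f x))\<^sup>2 + (norm (g x))\<^sup>2" for x
  proof -
    have "\<bar>f x \<bullet> g x\<bar> \<le> norm (f x) * norm (g x)"
      by (rule Cauchy_Schwarz_ineq2)
    also have "\<dots> \<le> (norm (f x))\<^sup>2 + (norm (g x))\<^sup>2"
      using sum_squares_bound[of "norm (f x)" "norm (g x)"]
        mult_nonneg_nonneg[OF norm_ge_zero[of "f x"] norm_ge_zero[of "g x"]]
      by linarith
    finally show ?thesis .
  qed
  then show "AE x in lebesgue_on (box a b). norm (f x \<bullet> g x) \<le> norm ((norm (f x))\<^sup>2 + (norm (g x))\<^sup>2)"
    by simp
qed

text \<open>Integrating \<open>(v - w) \<bullet> v = (|v|\<^sup>2 - |w|\<^sup>2 + |v - w|\<^sup>2) / 2\<close>; the last term is the numerical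
  dissipation of the implicit Euler step.\<close>

lemma l2_inner_increment:
  assumes v: "continuous_on (cbox a b) v" and w: "continuous_on (cbox a b) w"
  shows "l2_inner (box a b) (\<lambda>x. v x - w x) v
    = energy (box a b) v - energy (box a b) w + 1 / 2 * (l2_norm (box a b) (\<lambda>x. v x - w x))\<^sup>2"
proof -
  have int: "integrable (lebesgue_on (box a b)) (\<lambda>x. v x \<bullet> v x)"
    "integrable (lebesgue_on (box a b)) (\<lambda>x. w x \<bullet> w x)"
    "integrable (lebesgue_on (box a b)) (\<lambda>x. (v x - w x) \<bullet> (v x - w x))"
    by (intro integrable_on_box continuous_intros v w)+
  have "(v x - w x) \<bullet> v x
      = 1 / 2 * (v x \<bullet> v x) - 1 / 2 * (w x \<bullet> w x) + 1 / 2 * ((v x - w x) \<bullet> (v x - w x))" for x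
    by (simp add: inner_diff_left inner_diff_right inner_commute[of "w x" "v x"] field_simps)
  then have "l2_inner (box a b) (\<lambda>x. v x - w x) v = integral\<^sup>L (lebesgue_on (box a b))
      (\<lambda>x. 1 / 2 * (v x \<bullet> v x) - 1 / 2 * (w x \<bullet> w x) + 1 / 2 * ((v x - w x) \<bullet> (v x - w x)))"
    by (simp only: l2_inner_def)
  then show ?thesis
    using int by (simp add: energy_def l2_norm_power2) (simp add: l2_inner_def)
qed

section \<open>Integration by parts on a box\<close>

lemma bounded_bilinear_mult_nth:
  "bounded_bilinear (\<lambda>(r::real) (v::real ^ 'd). r * v $ i)"
  by (rule bounded_bilinear.comp[OF bounded_bilinear_mult bounded_linear_ident bounded_linear_vec_nth])

context
  fixes a b :: "real ^ 'd"
  assumes ab: "\<forall>i. a $ i < b $ i"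
begin

lemma closure_box_eq_cbox: "closure (box a b) = cbox a b"
  using ab by (intro closure_box) (simp add: interval_ne_empty_cart)

lemma C1_closure_has_derivative:
  assumes "C1_closure (box a b) f" "x \<in> cbox a b"
  shows "(f has_derivative frechet_derivative f (at x within cbox a b)) (at x within cbox a b)"
  using assms unfolding C1_closure_def closure_box_eq_cbox
  by (simp add: differentiable_on_def flip: frechet_derivative_works)

lemma C1_closure_continuous_on:
  assumes "C1_closure (box a b) f"
  shows "continuous_on (cbox a b) f"
  using assms unfolding C1_closure_def closure_box_eq_cbox
  by (simp add: differentiable_imp_continuous_on)

lemma C1_closure_continuous_on_partial:
  assumes "C1_closure (box a b) f"
  shows "continuous_on (cbox a b) (partial_deriv (box a b) i f)"
  using assms unfolding C1_closure_def closure_box_eq_cbox by simp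

text \<open>The product rule turns the vanishing integral of a derivative into an integration by parts
  without boundary term. A general bilinear product covers both \<open>p v\<^sub>i\<close> and \<open>\<partial>\<^sub>i v \<bullet> v\<close>.\<close>

lemma integral_partial_derivs_of_product_eq_0:
  fixes f :: "real ^ 'd \<Rightarrow> 'b::euclidean_space" and g :: "real ^ 'd \<Rightarrow> 'c::euclidean_space"
    and prod :: "'b \<Rightarrow> 'c \<Rightarrow> 'e::euclidean_space"
  assumes prod: "bounded_bilinear prod"
    and f: "C1_closure (box a b) f" and g: "C1_closure (box a b) g"
    and faces: "faces_match a b (\<lambda>x. prod (f x) (g x))"
  shows "integral\<^sup>L (lebesgue_on (box a b))
           (\<lambda>x. prod (f x) (partial_deriv (box a b) i g x) + prod (partial_deriv (box a b) i f x) (g x)) = 0"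
proof -
  define D where "D x h = prod (f x) (frechet_derivative g (at x within cbox a b) h)
      + prod (frechet_derivative f (at x within cbox a b) h) (g x)" for x h
  have D: "D x (axis i 1) =
      prod (f x) (partial_deriv (box a b) i g x) + prod (partial_deriv (box a b) i f x) (g x)" for x
    by (simp add: D_def partial_deriv_def closure_box_eq_cbox)
  have "integral\<^sup>L (lebesgue_on (box a b)) (\<lambda>x. D x (axis i 1)) = 0"
  proof (rule integral_box_directional_derivative_eq_0)
    show "axis i 1 \<in> (Basis :: (real ^ 'd) set)"
      by (simp add: axis_in_Basis_iff)
    show "a \<bullet> axis i 1 \<le> b \<bullet> axis i 1"
      using ab by (simp add: inner_axis less_imp_le)
    show "((\<lambda>x. prod (f x) (g x)) has_derivative D x) (at x within cbox a b)" if "x \<in> cbox a b" for x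
      unfolding D_def
      by (intro bounded_bilinear.FDERIV[OF prod] C1_closure_has_derivative f g that)
    show "continuous_on (cbox a b) (\<lambda>x. D x (axis i 1))"
      unfolding D
      by (intro continuous_on_add bounded_bilinear.continuous_on[OF prod] C1_closure_continuous_on
          C1_closure_continuous_on_partial f g)
    show "prod (f (x + (b \<bullet> axis i 1 - a \<bullet> axis i 1) *\<^sub>R axis i 1))
            (g (x + (b \<bullet> axis i 1 - a \<bullet> axis i 1) *\<^sub>R axis i 1)) = prod (f x) (g x)"
      if "x \<in> cbox a b" "x \<bullet> axis i 1 = a \<bullet> axis i 1" for x
    proof -
      have "c *\<^sub>R axis i (1::real) = axis i c" for c
        by (simp add: vec_eq_iff axis_def)
      then show ?thesis
        using faces that by (simp add: faces_match_def inner_axis)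
    qed
  qed
  then show ?thesis by (simp add: D)
qed

lemma faces_match_if_zero_on_frontier:
  assumes "\<And>x. x \<in> frontier (box a b) \<Longrightarrow> g x = 0"
  shows "faces_match a b g"
  unfolding faces_match_def
proof (intro allI ballI impI)
  fix i x
  assume x: "x \<in> cbox a b" "x $ i = a $ i"
  have fr: "y \<in> frontier (box a b)" if "y \<in> cbox a b" "y $ i = a $ i \<or> y $ i = b $ i" for y
    using that unfolding frontier_def closure_box_eq_cbox interior_open[OF open_box]
    by (simp add: mem_box_cart) (metis less_irrefl)
  have "x + axis i (b $ i - a $ i) \<in> cbox a b"
    using x ab by (auto simp: mem_box_cart axis_def less_imp_le)
  moreover have "(x + axis i (b $ i - a $ i)) $ i = b $ i"
    using x by (simp add: axis_def)
  ultimately show "g (x + axis i (b $ i - a $ i)) = g x"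
    using fr x assms by metis
qed

text \<open>Summing \<open>\<integral> \<partial>\<^sub>i (p v\<^sub>i) = 0\<close> over \<open>i\<close>.\<close>

lemma l2_inner_gradient_divergence:
  assumes p: "C1_closure (box a b) p" and v: "C1_closure (box a b) v"
    and faces: "\<And>i. faces_match a b (\<lambda>x. p x * v x $ i)"
  shows "l2_inner (box a b) (gradient (box a b) p) v = - l2_inner (box a b) p (divergence (box a b) v)"
proof -
  let ?I = "integral\<^sup>L (lebesgue_on (box a b))"
  let ?d = "partial_deriv (box a b)"
  note [continuous_intros] = C1_closure_continuous_on C1_closure_continuous_on_partial
  have int: "integrable (lebesgue_on (box a b)) (\<lambda>x. p x * ?d i v x $ i)"
    "integrable (lebesgue_on (box a b)) (\<lambda>x. ?d i p x * v x $ i)" for i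
    by (intro integrable_on_box continuous_intros p v)+
  have "l2_inner (box a b) p (divergence (box a b) v) + l2_inner (box a b) (gradient (box a b) p) v
      = (\<Sum>i\<in>UNIV. ?I (\<lambda>x. p x * ?d i v x $ i) + ?I (\<lambda>x. ?d i p x * v x $ i))"
    by (simp add: l2_inner_def divergence_def gradient_def inner_vec_def sum_distrib_left sum.distrib int)
  also have "\<dots> = (\<Sum>i\<in>UNIV. ?I (\<lambda>x. p x * ?d i v x $ i + ?d i p x * v x $ i))"
    by (simp add: int)
  also have "\<dots> = 0"
    by (intro sum.neutral ballI
        integral_partial_derivs_of_product_eq_0[OF bounded_bilinear_mult_nth p v faces])
  finally show ?thesis by simp
qed

text \<open>Summing \<open>\<integral> \<partial>\<^sub>i (\<partial>\<^sub>i v \<bullet> v) = 0\<close> over \<open>i\<close>.\<close>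

lemma l2_inner_vlaplacian:
  assumes v: "C2_closure (box a b) v"
    and faces: "\<And>i. faces_match a b (\<lambda>x. partial_deriv (box a b) i v x \<bullet> v x)"
  shows "l2_inner (box a b) (vlaplacian (box a b) v) v = - (l2_norm (box a b) (vgradient (box a b) v))\<^sup>2"
proof -
  let ?I = "integral\<^sup>L (lebesgue_on (box a b))"
  let ?d = "partial_deriv (box a b)"
  have v1: "C1_closure (box a b) v" and v2: "C1_closure (box a b) (?d i v)" for i
    using v by (auto simp: C2_closure_def)
  note [continuous_intros] = C1_closure_continuous_on C1_closure_continuous_on_partial
  have int: "integrable (lebesgue_on (box a b)) (\<lambda>x. ?d i v x \<bullet> ?d i v x)"
    "integrable (lebesgue_on (box a b)) (\<lambda>x. ?d i (?d i v) x \<bullet> v x)" for i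
    by (intro integrable_on_box continuous_intros v1 v2)+
  have grad: "vgradient (box a b) v x \<bullet> vgradient (box a b) v x = (\<Sum>i\<in>UNIV. ?d i v x \<bullet> ?d i v x)" for x
    unfolding vgradient_def inner_vec_def by (simp, rule sum.swap)
  have "(l2_norm (box a b) (vgradient (box a b) v))\<^sup>2 + l2_inner (box a b) (vlaplacian (box a b) v) v
      = (\<Sum>i\<in>UNIV. ?I (\<lambda>x. ?d i v x \<bullet> ?d i v x) + ?I (\<lambda>x. ?d i (?d i v) x \<bullet> v x))"
    unfolding l2_norm_power2
    by (simp add: l2_inner_def grad vlaplacian_def inner_sum_left sum.distrib int)
  also have "\<dots> = (\<Sum>i\<in>UNIV. ?I (\<lambda>x. ?d i v x \<bullet> ?d i v x + ?d i (?d i v) x \<bullet> v x))"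
    by (simp add: int)
  also have "\<dots> = 0"
    by (intro sum.neutral ballI
        integral_partial_derivs_of_product_eq_0[OF bounded_bilinear_inner v2 v1 faces])
  finally show ?thesis by simp
qed

section \<open>The nonlinear term and the energy law\<close>

lemma continuous_on_G_op:
  assumes "C1_closure (box a b) w"
  shows "continuous_on (cbox a b) (G_op (box a b) F w)"
proof -
  note [continuous_intros] = C1_closure_continuous_on[OF assms] C1_closure_continuous_on_partial[OF assms]
  have "continuous_on (cbox a b) (convection (box a b) w)"
    unfolding convection_def by (intro continuous_intros)
  then show ?thesis
    unfolding G_op_def by (auto intro: continuous_on_scaleR)
qed

text \<open>The two products cancel for any value of \<open>G_op\<close>, so this covers also the case in which \<open>w\<close> has
  norm zero and \<open>G_op\<close> is set to zero. Integrability of \<open>F w \<bullet> v\<close> and \<open>G w \<bullet> v\<close> is what allows the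
  integral to be split; the first part of the conclusion serves the same purpose when the whole
  momentum equation is integrated.\<close>

lemma B_op_energy_neutral:
  assumes w: "C1_closure (box a b) w" and v: "continuous_on (cbox a b) v"
    and F: "square_integrable (box a b) (F w)"
  shows "integrable (lebesgue_on (box a b)) (\<lambda>x. B_op (box a b) F w v x \<bullet> v x)"
    and "l2_inner (box a b) (B_op (box a b) F w v) v = 0"
proof -
  note int = integrable_inner_square_integrable[OF F v]
    integrable_on_box[OF continuous_on_inner[OF continuous_on_G_op[OF w, of F] v]]
  show "integrable (lebesgue_on (box a b)) (\<lambda>x. B_op (box a b) F w v x \<bullet> v x)"
    unfolding B_op_def by (simp add: inner_diff_left int)
  have "l2_inner (box a b) (B_op (box a b) F w v) v
      = l2_inner (box a b) (F w) v * l2_inner (box a b) (G_op (box a b) F w) v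
        - l2_inner (box a b) (G_op (box a b) F w) v * l2_inner (box a b) (F w) v"
    unfolding l2_inner_def[of _ "B_op (box a b) F w v"] B_op_def
    by (simp add: inner_diff_left int) (simp add: l2_inner_def)
  then show "l2_inner (box a b) (B_op (box a b) F w v) v = 0" by simp
qed

text \<open>The momentum equation tested with the new velocity \<open>v\<close>.\<close>

lemma bdf1_step_energy_law:
  assumes w: "C2_closure (box a b) w" and v: "C2_closure (box a b) v" and p: "C1_closure (box a b) p"
    and F: "square_integrable (box a b) (F w)"
    and bc: "dirichlet_bc (box a b) v \<or> periodic_velocity a b v \<and> periodic_pressure a b p"
    and f: "\<And>x. x \<in> box a b \<Longrightarrow> f x = 0"
    and step: "bdf1_step (box a b) \<nu> \<tau> F f w v p"
  shows "(energy (box a b) v - energy (box a b) w) / \<tau>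
    = - \<nu> * (l2_norm (box a b) (vgradient (box a b) v))\<^sup>2
      - 1 / (2 * \<tau>) * (l2_norm (box a b) (\<lambda>x. v x - w x))\<^sup>2"
proof -
  let ?\<Omega> = "box a b"
  let ?d = "partial_deriv ?\<Omega>"
  have w1: "C1_closure ?\<Omega> w" and v1: "C1_closure ?\<Omega> v" and v2: "C1_closure ?\<Omega> (?d i v)" for i
    using w v by (auto simp: C2_closure_def)
  note cont = C1_closure_continuous_on[OF w1] C1_closure_continuous_on[OF v1]
    C1_closure_continuous_on_partial[OF p] C1_closure_continuous_on_partial[OF v2]
  have faces_p: "faces_match a b (\<lambda>x. p x * v x $ i)" for i
    using bc
  proof
    assume "dirichlet_bc ?\<Omega> v"
    then show ?thesis
      by (intro faces_match_if_zero_on_frontier) (simp add: dirichlet_bc_def)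
  qed (simp add: periodic_velocity_def periodic_pressure_def faces_match_def)
  have faces_v: "faces_match a b (\<lambda>x. ?d i v x \<bullet> v x)" for i
    using bc
  proof
    assume "dirichlet_bc ?\<Omega> v"
    then show ?thesis
      by (intro faces_match_if_zero_on_frontier) (simp add: dirichlet_bc_def)
  qed (simp add: periodic_velocity_def faces_match_def)
  have int: "integrable (lebesgue_on ?\<Omega>) (\<lambda>x. (v x - w x) \<bullet> v x)"
    "integrable (lebesgue_on ?\<Omega>) (\<lambda>x. vlaplacian ?\<Omega> v x \<bullet> v x)"
    "integrable (lebesgue_on ?\<Omega>) (\<lambda>x. gradient ?\<Omega> p x \<bullet> v x)"
    unfolding vlaplacian_def gradient_def by (intro integrable_on_box continuous_intros cont)+
  note B = B_op_energy_neutral[where F = F, OF w1 cont(2) F]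
  have pressure: "l2_inner ?\<Omega> (gradient ?\<Omega> p) v = 0"
  proof -
    have "l2_inner ?\<Omega> p (divergence ?\<Omega> v) = integral\<^sup>L (lebesgue_on ?\<Omega>) (\<lambda>x. 0)"
      unfolding l2_inner_def
      by (rule Bochner_Integration.integral_cong[OF refl]) (use step in \<open>simp add: bdf1_step_def\<close>)
    then show ?thesis
      by (simp add: l2_inner_gradient_divergence[OF p v1 faces_p])
  qed
  have "integral\<^sup>L (lebesgue_on ?\<Omega>) (\<lambda>x. (v x - w x) \<bullet> v x / \<tau> - \<nu> * (vlaplacian ?\<Omega> v x \<bullet> v x)
      + B_op ?\<Omega> F w v x \<bullet> v x + gradient ?\<Omega> p x \<bullet> v x) = integral\<^sup>L (lebesgue_on ?\<Omega>) (\<lambda>x. 0)"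
  proof (rule Bochner_Integration.integral_cong[OF refl])
    fix x assume "x \<in> space (lebesgue_on ?\<Omega>)"
    then have "(v x - w x) /\<^sub>R \<tau> - \<nu> *\<^sub>R vlaplacian ?\<Omega> v x + B_op ?\<Omega> F w v x + gradient ?\<Omega> p x = 0"
      using step f by (simp add: bdf1_step_def)
    from arg_cong[OF this, of "\<lambda>z. z \<bullet> v x"]
    show "(v x - w x) \<bullet> v x / \<tau> - \<nu> * (vlaplacian ?\<Omega> v x \<bullet> v x)
        + B_op ?\<Omega> F w v x \<bullet> v x + gradient ?\<Omega> p x \<bullet> v x = 0"
      by (simp add: inner_add_left inner_diff_left[of "_ /\<^sub>R _"] divide_inverse mult.commute)
  qed
  then have "l2_inner ?\<Omega> (\<lambda>x. v x - w x) v / \<tau> - \<nu> * l2_inner ?\<Omega> (vlaplacian ?\<Omega> v) v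
      + l2_inner ?\<Omega> (B_op ?\<Omega> F w v) v + l2_inner ?\<Omega> (gradient ?\<Omega> p) v = 0"
    using int B(1) by (simp add: l2_inner_def)
  then have "l2_inner ?\<Omega> (\<lambda>x. v x - w x) v / \<tau>
      = - \<nu> * (l2_norm ?\<Omega> (vgradient ?\<Omega> v))\<^sup>2"
    by (simp add: B(2) pressure l2_inner_vlaplacian[OF v faces_v])
  then show ?thesis
    unfolding l2_inner_increment[OF cont(2,1)] by (simp add: add_divide_distrib diff_divide_distrib)
qed

end


theorem theorem3p2:
  fixes a b :: "real ^ 'd"
    and \<Omega> :: "(real ^ 'd) set"
    and \<nu> T \<tau> :: real
    and N\<^sub>t :: nat
    and t :: "nat \<Rightarrow> real"
    and F :: "'d vfield \<Rightarrow> 'd vfield"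
    and f :: "real \<Rightarrow> 'd vfield"
    and u :: "nat \<Rightarrow> 'd vfield"
    and p :: "nat \<Rightarrow> 'd sfield"
  assumes dim: "CARD('d) = 2 \<or> CARD('d) = 3"
    and domain: "\<forall>i. a $ i < b $ i" "\<Omega> = box a b"
    and params: "\<nu> > 0" "T > 0" "N\<^sub>t > 0" "\<tau> = T / real N\<^sub>t" "\<forall>n. t n = real n * \<tau>"
    and nondeg: "nondegenerate \<Omega> F"
    and smooth_u: "\<forall>n\<le>N\<^sub>t. C2_closure \<Omega> (u n)"
    and smooth_p: "\<forall>n<N\<^sub>t. C1_closure \<Omega> (p (n + 1))"
    and smooth_F: "\<forall>n<N\<^sub>t. square_integrable \<Omega> (F (u n))"
    and bc: "(\<forall>n<N\<^sub>t. dirichlet_bc \<Omega> (u (n + 1))) \<or>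
             (\<forall>n<N\<^sub>t. periodic_velocity a b (u (n + 1)) \<and> periodic_pressure a b (p (n + 1)))"
    and no_force: "\<forall>s\<in>{0..T}. \<forall>x\<in>\<Omega>. f s x = 0"
    and scheme: "\<forall>n<N\<^sub>t. bdf1_step \<Omega> \<nu> \<tau> F (f (t (n + 1))) (u n) (u (n + 1)) (p (n + 1))"
  shows "\<forall>n<N\<^sub>t.
           (energy \<Omega> (u (n + 1)) - energy \<Omega> (u n)) / \<tau>
             = - \<nu> * (l2_norm \<Omega> (vgradient \<Omega> (u (n + 1))))\<^sup>2
               - 1 / (2 * \<tau>) * (l2_norm \<Omega> (\<lambda>x. u (n + 1) x - u n x))\<^sup>2"
proof (intro allI impI)
  fix n assume n: "n < N\<^sub>t"
  \<comment> \<open>\<open>f\<close> vanishes only on \<open>{0..T}\<close>, so \<open>t (n + 1)\<close> has to be placed in that interval.\<close>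
  have "t (n + 1) = T * (real (n + 1) / real N\<^sub>t)"
    using params by simp
  moreover have "T * (real (n + 1) / real N\<^sub>t) \<le> T * 1"
    using n params by (intro mult_left_mono) auto
  moreover have "0 \<le> T * (real (n + 1) / real N\<^sub>t)"
    using params by simp
  ultimately have "t (n + 1) \<in> {0..T}"
    by simp
  then have force: "\<And>x. x \<in> box a b \<Longrightarrow> f (t (n + 1)) x = 0"
    using no_force domain by simp
  have bc_n: "dirichlet_bc (box a b) (u (n + 1)) \<or>
      periodic_velocity a b (u (n + 1)) \<and> periodic_pressure a b (p (n + 1))"
    using bc n domain by blast
  show "(energy \<Omega> (u (n + 1)) - energy \<Omega> (u n)) / \<tau>
      = - \<nu> * (l2_norm \<Omega> (vgradient \<Omega> (u (n + 1))))\<^sup>2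
        - 1 / (2 * \<tau>) * (l2_norm \<Omega> (\<lambda>x. u (n + 1) x - u n x))\<^sup>2"
    unfolding domain(2)
  proof (rule bdf1_step_energy_law[where F = F and f = "f (t (n + 1))" and p = "p (n + 1)", OF domain(1)])
    show "C2_closure (box a b) (u n)" "C2_closure (box a b) (u (n + 1))"
      using smooth_u n domain(2) by simp_all
    show "C1_closure (box a b) (p (n + 1))"
      using smooth_p n domain(2) by simp
    show "square_integrable (box a b) (F (u n))"
      using smooth_F n domain(2) by simp
    show "bdf1_step (box a b) \<nu> \<tau> F (f (t (n + 1))) (u n) (u (n + 1)) (p (n + 1))"
      using scheme n domain(2) by blast
  qed (use bc_n force in auto)
qed

end
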